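(* Let $C$ be a unital composition algebra over a field $F$ of characteristic zero. Then $\mathrm{rb}(C)=1$ if $C$ is a division algebra or $\dim C\le2$, and $\mathrm{rb}(C)=3$ if $C$ is split and $\dim C\in\{4,8\}$.
   Context: An algebra $A$ over $F$ ($\mathrm{char}\,F\ne2$) is a composition algebra if there is a nondegenerate quadratic form $n$ on $A$ with $n(xy)=n(x)n(y)$ for all $x,y$; a unital one has dimension 1, 2, 4 or 8, and it is split if $n(x)=0$ for some nonzero $x$, otherwise it is a division algebra. A linear operator $R$ on $A$ is a Rota–Baxter operator of weight $0$ if $R(x)R(y)=R(R(x)y+xR(y))$ for all $x,y$. The RB-index $\mathrm{rb}(A)$ is the least $n\in\mathbb N$ such that $R^n=0$ for every Rota–Baxter operator $R$ of weight zero on $A$. *)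

theory Defs
  imports Complex_Main
begin

text \<open>An algebra over a field F is modelled by a carrier type 'v with an
F-vector-space structure given by the scalar multiplication scale, and a
(not necessarily associative) bilinear multiplication mult.\<close>

definition bilinear_mult :: "('a::field \<Rightarrow> 'v::ab_group_add \<Rightarrow> 'v) \<Rightarrow> ('v \<Rightarrow> 'v \<Rightarrow> 'v) \<Rightarrow> bool" where
  "bilinear_mult scale mult \<longleftrightarrow>
     (\<forall>x. Vector_Spaces.linear scale scale (mult x)) \<and>
     (\<forall>y. Vector_Spaces.linear scale scale (\<lambda>x. mult x y))"

definition polar_form :: "('v::ab_group_add \<Rightarrow> 'a::field) \<Rightarrow> 'v \<Rightarrow> 'v \<Rightarrow> 'a" where
  "polar_form q x y = q (x + y) - q x - q y"

definition quadratic_form :: "('a::field \<Rightarrow> 'v::ab_group_add \<Rightarrow> 'v) \<Rightarrow> ('v \<Rightarrow> 'a) \<Rightarrow> bool" where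
  "quadratic_form scale q \<longleftrightarrow>
     (\<forall>a x. q (scale a x) = a ^ 2 * q x) \<and>
     (\<forall>x. Vector_Spaces.linear scale (*) (polar_form q x)) \<and>
     (\<forall>y. Vector_Spaces.linear scale (*) (\<lambda>x. polar_form q x y))"

definition nondegenerate_qf :: "('v::ab_group_add \<Rightarrow> 'a::field) \<Rightarrow> bool" where
  "nondegenerate_qf q \<longleftrightarrow> (\<forall>x. (\<forall>y. polar_form q x y = 0) \<longrightarrow> x = 0)"

definition composition_algebra ::
  "('a::field \<Rightarrow> 'v::ab_group_add \<Rightarrow> 'v) \<Rightarrow> ('v \<Rightarrow> 'v \<Rightarrow> 'v) \<Rightarrow> ('v \<Rightarrow> 'a) \<Rightarrow> bool" where
  "composition_algebra scale mult q \<longleftrightarrow>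
     vector_space scale \<and> bilinear_mult scale mult \<and>
     quadratic_form scale q \<and> nondegenerate_qf q \<and>
     (\<forall>x y. q (mult x y) = q x * q y)"

definition unital :: "('v::ab_group_add \<Rightarrow> 'v \<Rightarrow> 'v) \<Rightarrow> bool" where
  "unital mult \<longleftrightarrow> (\<exists>e. e \<noteq> 0 \<and> (\<forall>x. mult e x = x \<and> mult x e = x))"

definition split_ca :: "('v::ab_group_add \<Rightarrow> 'a::field) \<Rightarrow> bool" where
  "split_ca q \<longleftrightarrow> (\<exists>x. x \<noteq> 0 \<and> q x = 0)"

definition division_ca :: "('v::ab_group_add \<Rightarrow> 'a::field) \<Rightarrow> bool" where
  "division_ca q \<longleftrightarrow> \<not> split_ca q"

definition rota_baxter0 ::
  "('a::field \<Rightarrow> 'v::ab_group_add \<Rightarrow> 'v) \<Rightarrow> ('v \<Rightarrow> 'v \<Rightarrow> 'v) \<Rightarrow> ('v \<Rightarrow> 'v) \<Rightarrow> bool" where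
  "rota_baxter0 scale mult R \<longleftrightarrow>
     Vector_Spaces.linear scale scale R \<and>
     (\<forall>x y. mult (R x) (R y) = R (mult (R x) y + mult x (R y)))"

definition rb_index ::
  "('a::field \<Rightarrow> 'v::ab_group_add \<Rightarrow> 'v) \<Rightarrow> ('v \<Rightarrow> 'v \<Rightarrow> 'v) \<Rightarrow> nat" where
  "rb_index scale mult =
     (LEAST n. \<forall>R. rota_baxter0 scale mult R \<longrightarrow> (R ^^ n) = (\<lambda>_. 0))"

end

theory Submission
  imports Defs
begin

text \<open>
  The image of a Rota-Baxter operator \<open>R\<close> of weight zero is a subalgebra that does not contain
  the unit, since \<open>R x = 1\<close> would give \<open>1 = R (2 x) = 2\<close>.  As \<open>y y = t(y) y - q(y) 1\<close> for all
  \<open>y\<close>, the norm vanishes on the image; hence \<open>R = 0\<close> in the division case.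
  The same quadratic identity turns the Rota-Baxter identity for the pair \<open>x, x\<close> into
  \<open>t(x) R (R x) = \<langle>x, R x\<rangle> R 1\<close>, and \<open>R (R 1) = 0\<close>, so \<open>R\<close> cubed kills every \<open>x\<close> of nonzero
  trace, and therefore everything.

  A split algebra contains an idempotent \<open>e\<close> of norm zero and trace one.  If \<open>e\<close> and \<open>1 - e\<close>
  span the algebra, then \<open>R = 0\<close>.  Otherwise (up to exchanging \<open>e\<close> and \<open>1 - e\<close>) there is
  \<open>u \<noteq> 0\<close> with \<open>e u = u\<close> and \<open>u e = 0\<close>, and \<open>R x = \<langle>u, x\<rangle> e + \<langle>1 - e, x\<rangle> u\<close> is a
  Rota-Baxter operator whose square is \<open>x \<mapsto> \<langle>u, x\<rangle> u\<close>.

  Since \<open>dim\<close> is \<open>0\<close> on infinite-dimensional spaces, the case \<open>dim \<le> 2\<close> also requires that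
  unital composition algebras have finite dimension.
\<close>

section \<open>Bilinearity rules and the polar form\<close>

locale unital_composition_algebra = vector_space scale
  for scale :: "'a::field_char_0 \<Rightarrow> 'v::ab_group_add \<Rightarrow> 'v" (infixr \<open>*s\<close> 75) +
  fixes mult :: "'v \<Rightarrow> 'v \<Rightarrow> 'v" (infixl \<open>\<odot>\<close> 70)
    and q :: "'v \<Rightarrow> 'a"
    and one :: 'v (\<open>\<one>\<close>)
  assumes composition: "composition_algebra scale mult q"
    and one_nonzero: "\<one> \<noteq> 0"
    and one_mult [simp]: "\<one> \<odot> x = x"
    and mult_one [simp]: "x \<odot> \<one> = x"
begin

abbreviation B :: "'v \<Rightarrow> 'v \<Rightarrow> 'a" where "B \<equiv> polar_form q"

abbreviation tr :: "'v \<Rightarrow> 'a" where "tr x \<equiv> B x \<one>"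

lemma mult_linear:
  "x \<odot> (y + z) = x \<odot> y + x \<odot> z" "(y + z) \<odot> x = y \<odot> x + z \<odot> x"
  "x \<odot> (a *s y) = a *s (x \<odot> y)" "(a *s y) \<odot> x = a *s (y \<odot> x)"
  using composition
  unfolding composition_algebra_def bilinear_mult_def Vector_Spaces.linear_iff by auto

lemma polar_linear:
  "B x (y + z) = B x y + B x z" "B (y + z) x = B y x + B z x"
  "B x (a *s y) = a * B x y" "B (a *s y) x = a * B y x"
  using composition
  unfolding composition_algebra_def quadratic_form_def Vector_Spaces.linear_iff by auto

lemma mult_zero [simp]: "x \<odot> 0 = 0" "0 \<odot> x = 0"
  using mult_linear(1)[of x 0 0] mult_linear(2)[of 0 0 x] by auto

lemma polar_zero [simp]: "B x 0 = 0" "B 0 x = 0"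
  using polar_linear(1)[of x 0 0] polar_linear(2)[of 0 0 x] by auto

lemma mult_minus: "x \<odot> (- y) = - (x \<odot> y)" "(- y) \<odot> x = - (y \<odot> x)"
  using mult_linear(3)[of x "-1" y] mult_linear(4)[of "-1" y x] by auto

lemma polar_minus: "B x (- y) = - B x y" "B (- y) x = - B y x"
  using polar_linear(3)[of x "-1" y] polar_linear(4)[of "-1" y x] by auto

lemma mult_diff: "x \<odot> (y - z) = x \<odot> y - x \<odot> z" "(y - z) \<odot> x = y \<odot> x - z \<odot> x"
  using mult_linear(1)[of x y "-z"] mult_linear(2)[of y "-z" x] by (auto simp: mult_minus)

lemma polar_diff: "B x (y - z) = B x y - B x z" "B (y - z) x = B y x - B z x"
  using polar_linear(1)[of x y "-z"] polar_linear(2)[of y "-z" x] by (auto simp: polar_minus)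

lemmas bilinear = mult_linear mult_minus mult_diff polar_linear polar_minus polar_diff

lemma polar_commute: "B x y = B y x"
  by (simp add: polar_form_def add.commute)

lemma norm_mult: "q (x \<odot> y) = q x * q y"
  using composition unfolding composition_algebra_def by blast

lemma norm_scale: "q (a *s x) = a ^ 2 * q x"
  using composition unfolding composition_algebra_def quadratic_form_def by blast

lemma norm_zero [simp]: "q 0 = 0"
  using norm_scale[of 0 0] by simp

lemma polar_self: "B x x = 2 * q x"
proof -
  have "x + x = 2 *s x"
    using scale_left_distrib[of 1 1 x] by simp
  then show ?thesis
    by (simp add: polar_form_def norm_scale)
qed

lemma norm_add: "q (x + y) = q x + q y + B x y"
  by (simp add: polar_form_def)

lemma polar_eqI:
  assumes "\<And>z. B x z = B y z"
  shows "x = y"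
proof -
  have "\<forall>z. B (x - y) z = 0"
    using assms by (simp add: bilinear)
  then have "x - y = 0"
    using composition unfolding composition_algebra_def nondegenerate_qf_def by blast
  then show ?thesis by simp
qed

lemma polar_nonzero:
  assumes "x \<noteq> 0"
  obtains z where "B x z \<noteq> 0"
  using polar_eqI[of x 0] assms by auto

text \<open>Nondegeneracy yields a vector of nonzero norm, where \<open>q x = q \<one> * q x\<close>
  can be cancelled.\<close>

lemma norm_one [simp]: "q \<one> = 1"
proof -
  obtain z where "B \<one> z \<noteq> 0"
    using polar_nonzero one_nonzero by blast
  then have "\<exists>x. q x \<noteq> 0"
    by (metis polar_form_def diff_self diff_zero)
  then show ?thesis
    using norm_mult[of \<one>] by auto
qed

lemma tr_one [simp]: "tr \<one> = 2"
  by (simp add: polar_self)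

section \<open>Linearized composition law and quadratic identities\<close>

lemma polar_mult_right: "B (x \<odot> z) (y \<odot> z) = B x y * q z"
  using norm_mult[of "x + y" z] by (simp add: bilinear norm_add norm_mult algebra_simps)

lemma polar_mult_left: "B (z \<odot> x) (z \<odot> y) = q z * B x y"
  using norm_mult[of z "x + y"] by (simp add: bilinear norm_add norm_mult algebra_simps)

lemma polar_mult_linearized: "B (x \<odot> z) (y \<odot> w) + B (x \<odot> w) (y \<odot> z) = B x y * B z w"
  using polar_mult_right[of x "z + w" y]
  by (simp add: bilinear norm_add polar_mult_right algebra_simps polar_commute[of w z])

text \<open>The adjoint of left multiplication by \<open>x\<close> is left multiplication by the
  conjugate \<open>tr x *s \<one> - x\<close>.\<close>

lemma polar_adjoint_left: "B (x \<odot> y) z = tr x * B y z - B y (x \<odot> z)"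
  using polar_mult_linearized[of x y \<one> z] by (simp add: algebra_simps polar_commute)

lemma polar_adjoint_right: "B (y \<odot> x) z = tr x * B y z - B y (z \<odot> x)"
  using polar_mult_linearized[of y x z \<one>] by (simp add: algebra_simps polar_commute)

lemma tr_mult: "tr (x \<odot> y) = tr x * tr y - B x y"
  using polar_adjoint_right[of x y \<one>] by simp

text \<open>Paired with \<open>z\<close>, the outer factor \<open>x\<close> moves across by
  adjointness, and \<open>B (x \<odot> y) (x \<odot> z)\<close> is \<open>q x * B y z\<close>. This
  and its mirror image stand in for associativity.\<close>

lemma left_quadratic: "x \<odot> (x \<odot> y) = tr x *s (x \<odot> y) - q x *s y"
proof (rule polar_eqI)
  fix z
  show "B (x \<odot> (x \<odot> y)) z = B (tr x *s (x \<odot> y) - q x *s y) z"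
    by (simp add: bilinear polar_adjoint_left[of x "x \<odot> y"] polar_mult_left)
qed

lemma right_quadratic: "(y \<odot> x) \<odot> x = tr x *s (y \<odot> x) - q x *s y"
proof (rule polar_eqI)
  fix z
  show "B ((y \<odot> x) \<odot> x) z = B (tr x *s (y \<odot> x) - q x *s y) z"
    by (simp add: bilinear polar_adjoint_right[of "y \<odot> x" x] polar_mult_right)
qed

lemma square_eq: "x \<odot> x = tr x *s x - q x *s \<one>"
  using left_quadratic[of x \<one>] by simp

lemma left_quadratic_linearized:
  "x \<odot> (y \<odot> z) + y \<odot> (x \<odot> z) = tr x *s (y \<odot> z) + tr y *s (x \<odot> z) - B x y *s z"
  using left_quadratic[of "x + y" z] left_quadratic[of x z] left_quadratic[of y z]
  by (simp add: bilinear norm_add algebra_simps)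

lemma mult_anticommutator:
  "x \<odot> y + y \<odot> x = tr x *s y + tr y *s x - B x y *s \<one>"
  using left_quadratic_linearized[of x y \<one>] by simp

subsection \<open>Finite dimension\<close>

lemma imaginary_anticommute:
  assumes "tr x = 0" "tr y = 0" "B x y = 0"
  shows "y \<odot> x = - (x \<odot> y)"
  using mult_anticommutator[of x y] assms by (simp add: eq_neg_iff_add_eq_0 add.commute)

text \<open>Three sign changes: swap \<open>y\<close> and \<open>z\<close>, move \<open>x\<close>
  past \<open>z\<close> by the linearized quadratic identity, then swap \<open>x \<odot> y\<close>
  and \<open>z\<close>.\<close>

lemma basic_triple_antiassociative:
  assumes "tr x = 0" "tr y = 0" "tr z = 0" "B x y = 0" "B x z = 0" "B y z = 0"
    and "B (x \<odot> y) z = 0"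
  shows "x \<odot> (y \<odot> z) = - ((x \<odot> y) \<odot> z)"
proof -
  have xy: "tr (x \<odot> y) = 0"
    using assms by (simp add: tr_mult)
  have "x \<odot> (y \<odot> z) = - (x \<odot> (z \<odot> y))"
    using imaginary_anticommute[of y z] assms by (simp add: bilinear)
  also have "\<dots> = z \<odot> (x \<odot> y)"
    using left_quadratic_linearized[of x z y] assms by (auto intro: minus_unique)
  also have "\<dots> = - ((x \<odot> y) \<odot> z)"
    using imaginary_anticommute[of "x \<odot> y" z] assms xy by simp
  finally show ?thesis .
qed

text \<open>The two ways around the associativity pentagon differ by a sign.\<close>

lemma no_four_anticommuting:
  assumes tr: "tr a = 0" "tr b = 0" "tr c = 0" "tr z = 0"
    and ab: "B a b = 0"
    and c: "B a c = 0" "B b c = 0" "B (a \<odot> b) c = 0"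
    and z: "B a z = 0" "B b z = 0" "B c z = 0" "B (a \<odot> b) z = 0" "B (a \<odot> c) z = 0"
      "B (b \<odot> c) z = 0" "B ((a \<odot> b) \<odot> c) z = 0"
  shows "q a * q b * q c * q z = 0"
proof -
  have [simp]: "tr (a \<odot> b) = 0" "tr (b \<odot> c) = 0" "tr (c \<odot> z) = 0"
    using assms by (simp_all add: tr_mult)
  have ba: "b \<odot> a = - (a \<odot> b)" and ca: "c \<odot> a = - (a \<odot> c)" and cb: "c \<odot> b = - (b \<odot> c)"
    and cab: "c \<odot> (a \<odot> b) = - ((a \<odot> b) \<odot> c)"
    using assms by (simp_all add: imaginary_anticommute)
  have a_bc: "B a (b \<odot> c) = 0"
    using polar_adjoint_left[of b c a] ba assms by (simp add: bilinear polar_commute)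
  have abc: "a \<odot> (b \<odot> c) = - ((a \<odot> b) \<odot> c)"
    using assms by (intro basic_triple_antiassociative) auto
  \<comment> \<open>Multiplication by the trace-zero \<open>c\<close> is skew; this gives the
    orthogonality conditions for the triples that contain \<open>c \<odot> z\<close>.\<close>
  have cz: "B w (c \<odot> z) = - B (c \<odot> w) z" for w
    using polar_adjoint_left[of c z w] assms by (simp add: polar_commute)
  have "a \<odot> (b \<odot> (c \<odot> z)) = - (a \<odot> ((b \<odot> c) \<odot> z))"
    using basic_triple_antiassociative[of b c z] assms by (simp add: bilinear)
  also have "\<dots> = (a \<odot> (b \<odot> c)) \<odot> z"
    using basic_triple_antiassociative[of a "b \<odot> c" z] assms a_bc abc by (simp add: bilinear)
  also have "\<dots> = - (((a \<odot> b) \<odot> c) \<odot> z)"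
    by (simp add: abc bilinear)
  finally have 1: "a \<odot> (b \<odot> (c \<odot> z)) = - (((a \<odot> b) \<odot> c) \<odot> z)" .
  have "a \<odot> (b \<odot> (c \<odot> z)) = - ((a \<odot> b) \<odot> (c \<odot> z))"
    using assms by (intro basic_triple_antiassociative) (auto simp: cz ca cb cab bilinear)
  also have "\<dots> = ((a \<odot> b) \<odot> c) \<odot> z"
    using basic_triple_antiassociative[of "a \<odot> b" c z] assms by simp
  finally have "((a \<odot> b) \<odot> c) \<odot> z = - (((a \<odot> b) \<odot> c) \<odot> z)"
    using 1 by metis
  then have "((a \<odot> b) \<odot> c) \<odot> z + ((a \<odot> b) \<odot> c) \<odot> z = 0"
    by (rule eq_neg_iff_add_eq_0[THEN iffD1])
  then have "2 *s (((a \<odot> b) \<odot> c) \<odot> z) = 0"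
    using scale_left_distrib[of 1 1 "((a \<odot> b) \<odot> c) \<odot> z"] by simp
  then have "((a \<odot> b) \<odot> c) \<odot> z = 0"
    by simp
  then have "q (((a \<odot> b) \<odot> c) \<odot> z) = 0"
    by simp
  then show ?thesis
    by (simp add: norm_mult)
qed

section \<open>Orthogonal families and their doubling\<close>

definition orthogonal_family :: "'v set \<Rightarrow> bool" where
  "orthogonal_family S \<longleftrightarrow>
     finite S \<and> (\<forall>x\<in>S. q x \<noteq> 0) \<and> (\<forall>x\<in>S. \<forall>y\<in>S. x \<noteq> y \<longrightarrow> B x y = 0)"

lemma polar_sum: "B (sum f S) y = (\<Sum>s\<in>S. B (f s) y)"
  by (induction S rule: infinite_finite_induct) (auto simp: bilinear)

text \<open>The orthogonal complement of \<open>S\<close> contains two vectors with nonzero pairing;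
  by polarization, \<open>q\<close> cannot vanish on both of them and on their sum.\<close>

lemma orthogonal_anisotropic_exists:
  assumes S: "orthogonal_family S" and span: "span S \<noteq> UNIV"
  shows "\<exists>v. q v \<noteq> 0 \<and> (\<forall>s\<in>S. B s v = 0)"
proof -
  have fin: "finite S"
    using S by (simp add: orthogonal_family_def)
  \<comment> \<open>Orthogonal projection onto the span of \<open>S\<close>; the 2 is there because
    \<open>B s s = 2 * q s\<close>.\<close>
  define P where "P x = (\<Sum>s\<in>S. (B x s / (2 * q s)) *s s)" for x
  have P: "B (x - P x) s = 0" if "s \<in> S" for x s
  proof -
    have "B (P x) s = (\<Sum>r\<in>S. if r = s then B x s else 0)"
      unfolding P_def polar_sum
      by (rule sum.cong[OF refl])
        (use S that in \<open>auto simp: orthogonal_family_def bilinear polar_self\<close>)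
    also have "\<dots> = B x s"
      using fin that by simp
    finally show ?thesis
      by (simp add: bilinear)
  qed
  have P_orth: "B (P y) w = 0" if "\<And>s. s \<in> S \<Longrightarrow> B w s = 0" for y w
    unfolding P_def polar_sum using that by (intro sum.neutral) (simp add: bilinear polar_commute)
  obtain x where x: "x \<notin> span S"
    using span by auto
  have "P x \<in> span S"
    unfolding P_def by (intro span_sum span_scale span_base)
  then have "x - P x \<noteq> 0"
    using x by auto
  then obtain y where "B (x - P x) y \<noteq> 0"
    using polar_nonzero by blast
  moreover have "B (x - P x) (P y) = 0"
    using P_orth[of "x - P x" y] P by (simp add: polar_commute)
  ultimately have "B (x - P x) (y - P y) \<noteq> 0"
    by (simp add: bilinear)
  then have "q (x - P x) \<noteq> 0 \<or> q (y - P y) \<noteq> 0 \<or> q ((x - P x) + (y - P y)) \<noteq> 0"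
    unfolding norm_add by auto
  moreover have "B s (x - P x) = 0" "B s (y - P y) = 0" "B s ((x - P x) + (y - P y)) = 0"
    if "s \<in> S" for s
    using P[OF that] polar_commute polar_linear(1) by (metis add.right_neutral)+
  ultimately show ?thesis
    by blast
qed

text \<open>A Cayley-Dickson step. By adjointness, \<open>B (x \<odot> c) y\<close> reduces to
  \<open>B c y\<close> and \<open>B c (x \<odot> y)\<close>, both zero; multiplication by
  \<open>c\<close> only scales the pairings within \<open>S\<close>.\<close>

lemma orthogonal_family_double:
  assumes S: "orthogonal_family S" and c: "q c \<noteq> 0" "\<And>s. s \<in> S \<Longrightarrow> B s c = 0"
    and closed: "\<And>x y. x \<in> S \<Longrightarrow> y \<in> S \<Longrightarrow> B (x \<odot> y) c = 0"
  shows "orthogonal_family (S \<union> (\<lambda>s. s \<odot> c) ` S)"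
proof -
  have cross: "B (x \<odot> c) y = 0" if "x \<in> S" "y \<in> S" for x y
    using polar_adjoint_left[of x c y] c(2)[OF that(2)] closed[OF that]
    by (simp add: polar_commute[of c])
  then have cross': "B y (x \<odot> c) = 0" if "x \<in> S" "y \<in> S" for x y
    using that polar_commute by metis
  have "B x y = 0" if "x \<in> S" "y \<in> S" "x \<odot> c \<noteq> y \<odot> c" for x y
    using S that by (auto simp: orthogonal_family_def)
  then show ?thesis
    using S c(1) unfolding orthogonal_family_def
    by (auto simp: norm_mult polar_mult_right cross cross')
qed

text \<open>If no orthogonal family spans, doubling produces families of 1, 2, 4 and 8 elements and
  then one more orthogonal anisotropic vector, against \<open>no_four_anticommuting\<close>.\<close>

lemma finite_dimensional: "\<exists>S. finite S \<and> span S = UNIV"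
proof (rule ccontr)
  assume "\<not> ?thesis"
  then have inf: "span S \<noteq> UNIV" if "orthogonal_family S" for S
    using that by (auto simp: orthogonal_family_def)
  have F1: "orthogonal_family {\<one>}"
    by (simp add: orthogonal_family_def)
  obtain a where a: "q a \<noteq> 0" "B \<one> a = 0"
    using orthogonal_anisotropic_exists[OF F1 inf[OF F1]] by auto
  have "orthogonal_family ({\<one>} \<union> (\<lambda>s. s \<odot> a) ` {\<one>})"
    using a by (intro orthogonal_family_double[OF F1]) auto
  then have F2: "orthogonal_family {\<one>, a}"
    by (simp add: insert_commute)
  obtain b where b: "q b \<noteq> 0" "B \<one> b = 0" "B a b = 0"
    using orthogonal_anisotropic_exists[OF F2 inf[OF F2]] by auto
  have aa: "a \<odot> a = - (q a *s \<one>)" and bb: "b \<odot> b = - (q b *s \<one>)"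
    using square_eq[of a] square_eq[of b] a b by (simp_all add: polar_commute)
  have "orthogonal_family ({\<one>, a} \<union> (\<lambda>s. s \<odot> b) ` {\<one>, a})"
    using a b by (intro orthogonal_family_double[OF F2]) (auto simp: aa bilinear)
  then have F4: "orthogonal_family {\<one>, a, b, a \<odot> b}"
    by (simp add: insert_commute)
  obtain c where c: "q c \<noteq> 0" "B \<one> c = 0" "B a c = 0" "B b c = 0" "B (a \<odot> b) c = 0"
    using orthogonal_anisotropic_exists[OF F4 inf[OF F4]] by auto
  have tr: "tr a = 0" "tr b = 0" "tr c = 0"
    using a b c by (simp_all add: polar_commute)
  then have tr_ab: "tr (a \<odot> b) = 0"
    using b by (simp add: tr_mult)
  \<comment> \<open>The quaternion multiplication table: products of members of the four-element
    family are multiples of members, hence orthogonal to \<open>c\<close>.\<close>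
  have ba: "b \<odot> a = - (a \<odot> b)"
    using b tr by (intro imaginary_anticommute) auto
  have a_ab: "a \<odot> (a \<odot> b) = - (q a *s b)" and ab_b: "(a \<odot> b) \<odot> b = - (q b *s a)"
    using left_quadratic[of a b] right_quadratic[of a b] tr by simp_all
  have b_ab: "b \<odot> (a \<odot> b) = q b *s a"
    using left_quadratic[of b a] tr by (simp add: ba bilinear)
  have ab_a: "(a \<odot> b) \<odot> a = q a *s b"
    using right_quadratic[of b a] tr by (simp add: ba bilinear)
  have ab_ab: "(a \<odot> b) \<odot> (a \<odot> b) = - (q (a \<odot> b) *s \<one>)"
    using square_eq[of "a \<odot> b"] tr_ab by simp
  have "orthogonal_family ({\<one>, a, b, a \<odot> b} \<union> (\<lambda>s. s \<odot> c) ` {\<one>, a, b, a \<odot> b})"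
    using c by (intro orthogonal_family_double[OF F4])
      (auto simp: aa bb ba a_ab ab_b b_ab ab_a ab_ab bilinear)
  then have F8: "orthogonal_family {\<one>, a, b, a \<odot> b, c, a \<odot> c, b \<odot> c, (a \<odot> b) \<odot> c}"
    by (simp add: insert_commute)
  obtain z where z: "q z \<noteq> 0"
    "\<forall>s \<in> {\<one>, a, b, a \<odot> b, c, a \<odot> c, b \<odot> c, (a \<odot> b) \<odot> c}. B s z = 0"
    using orthogonal_anisotropic_exists[OF F8 inf[OF F8]] by blast
  have "q a * q b * q c * q z = 0"
    using a b c z(2) tr by (intro no_four_anticommuting) (auto simp: polar_commute)
  then show False
    using a b c z by simp
qed

subsection \<open>Rota-Baxter operators\<close>

lemma rota_baxter_linear:
  assumes "rota_baxter0 scale mult R"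
  shows "R (x + y) = R x + R y" "R (a *s x) = a *s R x" "R (x - y) = R x - R y" "R 0 = 0"
proof -
  show add: "R (x + y) = R x + R y" and scale: "R (a *s x) = a *s R x" for x y a
    using assms unfolding rota_baxter0_def Vector_Spaces.linear_iff by auto
  show "R 0 = 0"
    using add[of 0 0] by simp
  show "R (x - y) = R x - R y"
    using add[of "x - y" y] by (metis add_diff_cancel diff_add_cancel)
qed

lemma rota_baxter_mult:
  assumes "rota_baxter0 scale mult R"
  shows "R x \<odot> R y = R (R x \<odot> y + x \<odot> R y)"
  using assms unfolding rota_baxter0_def by blast

lemma norm_rota_baxter:
  assumes R: "rota_baxter0 scale mult R"
  shows "q (R x) = 0"
proof (rule ccontr)
  assume nz: "q (R x) \<noteq> 0"
  note lin = rota_baxter_linear[OF R]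
  \<comment> \<open>By \<open>square_eq\<close>, \<open>q (R x) *s \<one>\<close> is
    \<open>tr (R x) *s R x - R x \<odot> R x\<close>; both terms lie in the image of
    \<open>R\<close>, and \<open>w\<close> is a preimage after division by the norm.\<close>
  define w where "w = (1 / q (R x)) *s (tr (R x) *s x - (R x \<odot> x + x \<odot> R x))"
  have "R w = (1 / q (R x)) *s (tr (R x) *s R x - R x \<odot> R x)"
    by (simp add: w_def lin rota_baxter_mult[OF R])
  then have w: "R w = \<one>"
    using nz by (simp add: square_eq[of "R x"])
  then have "\<one> = \<one> + \<one>"
    using rota_baxter_mult[OF R, of w w] by (simp add: lin)
  then show False
    using one_nonzero by simp
qed

text \<open>Two expressions for \<open>c \<odot> c\<close> make \<open>c = R \<one>\<close> an
  eigenvector of \<open>R\<close> with eigenvalue \<open>l\<close>; the Rota-Baxter identity at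
  \<open>c, c\<close> then reads \<open>2 l^3 c = 4 l^3 c\<close>.\<close>

lemma rota_baxter_one:
  assumes R: "rota_baxter0 scale mult R"
  shows "tr (R \<one>) = 0" and "R (R \<one>) = 0"
proof -
  note lin = rota_baxter_linear[OF R]
  define c where "c = R \<one>"
  define l where "l = tr c / 2"
  have cc: "c \<odot> c = (2 * l) *s c"
    using square_eq[of c] norm_rota_baxter[OF R, of \<one>] by (simp add: c_def l_def)
  moreover have "c \<odot> c = 2 *s R c"
    using rota_baxter_mult[OF R, of \<one> \<one>] scale_left_distrib[of 1 1 "R c"]
    by (simp add: c_def lin)
  ultimately have "2 *s R c = 2 *s (l *s c)"
    by simp
  then have Rc: "R c = l *s c"
    by (metis scale_cancel_left zero_neq_numeral)
  have "(l * l * (2 * l)) *s c = R c \<odot> R c"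
    by (simp add: Rc bilinear cc)
  also have "\<dots> = R ((2 * l * (2 * l)) *s c)"
    using rota_baxter_mult[OF R, of c c]
    by (simp add: Rc bilinear cc flip: scale_left_distrib)
  also have "\<dots> = (4 * l * l * l) *s c"
    by (simp add: lin Rc mult.assoc)
  finally have "(4 * l * l * l - l * l * (2 * l)) *s c = 0"
    by (simp add: scale_left_diff_distrib)
  then have "l = 0 \<or> c = 0"
    by (simp add: algebra_simps)
  then show "tr (R \<one>) = 0" "R (R \<one>) = 0"
    using Rc by (auto simp: l_def simp flip: c_def)
qed

lemma rota_baxter_square:
  assumes R: "rota_baxter0 scale mult R"
  shows "tr x *s R (R x) = B x (R x) *s R \<one>"
proof -
  note lin = rota_baxter_linear[OF R]
  have "tr (R x) *s R x = R (R x \<odot> x + x \<odot> R x)"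
    using rota_baxter_mult[OF R, of x x] square_eq[of "R x"] norm_rota_baxter[OF R, of x] by simp
  also have "\<dots> = tr (R x) *s R x + tr x *s R (R x) - B x (R x) *s R \<one>"
    by (simp add: mult_anticommutator lin polar_commute)
  finally show ?thesis
    by (simp add: algebra_simps)
qed

lemma rota_baxter_cube:
  assumes R: "rota_baxter0 scale mult R"
  shows "R (R (R x)) = 0"
proof -
  note lin = rota_baxter_linear[OF R]
  have *: "R (R (R x)) = 0" if "tr x \<noteq> 0" for x
  proof -
    have "tr x *s R (R (R x)) = R (tr x *s R (R x))"
      by (simp add: lin)
    also have "\<dots> = 0"
      by (simp add: rota_baxter_square[OF R] lin rota_baxter_one[OF R])
    finally show ?thesis
      using that by simp
  qed
  show ?thesis
  proof (cases "tr x = 0")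
    case True
    \<comment> \<open>Adding \<open>\<one>\<close> makes the trace 2 and leaves the cube unchanged,
      as \<open>R (R \<one>) = 0\<close>.\<close>
    then have "R (R (R (x + \<one>))) = 0"
      by (intro *) (simp add: bilinear)
    then show ?thesis
      by (simp add: lin rota_baxter_one[OF R])
  qed (rule *)
qed

lemma zero_rota_baxter: "rota_baxter0 scale mult (\<lambda>_. 0)"
  unfolding rota_baxter0_def Vector_Spaces.linear_iff
  using vector_space_axioms by simp

lemma rb_index_eq_1:
  assumes "\<And>R x. rota_baxter0 scale mult R \<Longrightarrow> R x = 0"
  shows "rb_index scale mult = 1"
  unfolding rb_index_def
proof (rule Least_equality)
  show "\<forall>R. rota_baxter0 scale mult R \<longrightarrow> R ^^ 1 = (\<lambda>_. 0)"
    using assms by auto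
next
  fix n :: nat
  assume "\<forall>R. rota_baxter0 scale mult R \<longrightarrow> R ^^ n = (\<lambda>_. 0)"
  \<comment> \<open>The zeroth power of any operator is the identity, which moves
    \<open>\<one>\<close>.\<close>
  then have "n \<noteq> 0"
    using zero_rota_baxter one_nonzero by (metis funpow_0)
  then show "1 \<le> n" by simp
qed

lemma rb_index_eq_3:
  assumes R: "rota_baxter0 scale mult R" and x: "R (R x) \<noteq> 0"
  shows "rb_index scale mult = 3"
  unfolding rb_index_def
proof (rule Least_equality)
  show "\<forall>R. rota_baxter0 scale mult R \<longrightarrow> R ^^ 3 = (\<lambda>_. 0)"
    by (auto simp: fun_eq_iff eval_nat_numeral rota_baxter_cube)
next
  fix n :: nat
  assume n: "\<forall>R. rota_baxter0 scale mult R \<longrightarrow> R ^^ n = (\<lambda>_. 0)"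
  show "3 \<le> n"
  proof (rule ccontr)
    assume "\<not> 3 \<le> n"
    then have "R ^^ 2 = R ^^ (2 - n) \<circ> R ^^ n"
      by (simp flip: funpow_add)
    moreover have "(R ^^ k) 0 = 0" for k
      by (induction k) (auto simp: rota_baxter_linear[OF R])
    ultimately have "(R ^^ 2) x = 0"
      using n R by simp
    then show False
      using x by (simp add: eval_nat_numeral)
  qed
qed

subsection \<open>Split algebras\<close>

lemma split_idempotent:
  assumes "split_ca q"
  obtains e where "q e = 0" "tr e = 1"
proof -
  obtain x where x: "x \<noteq> 0" "q x = 0"
    using assms by (auto simp: split_ca_def)
  obtain w where w: "B x w \<noteq> 0"
    using polar_nonzero x by blast
  \<comment> \<open>The product of \<open>x\<close> with the conjugate of \<open>w\<close> keeps
    norm zero and has trace \<open>B x w\<close>, so it can be scaled to trace one.\<close>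
  define y where "y = x \<odot> (tr w *s \<one> - w)"
  have "tr y = B x w"
    by (simp add: y_def bilinear tr_mult)
  moreover have "q y = 0"
    by (simp add: y_def norm_mult x)
  ultimately show ?thesis
    using that[of "(1 / tr y) *s y"] w by (simp add: norm_scale bilinear)
qed

lemma idempotent_polar:
  assumes "q e = 0" "tr e = 1"
  shows "B e (\<one> - e) = 1" "q (\<one> - e) = 0" "tr (\<one> - e) = 1" "e \<odot> e = e"
  using assms square_eq[of e] norm_add[of "\<one> - e" e]
  by (auto simp: bilinear polar_self polar_commute)

text \<open>In the coordinates given by \<open>e\<close> and \<open>f\<close> the norm is the
  product and the trace the sum, so \<open>R \<one>\<close>, with both zero, vanishes. Then
  \<open>R f = - R e\<close> and \<open>R\<close> squares to zero, which forces
  \<open>R e = 0\<close>.\<close>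

lemma rota_baxter_zero_two_dimensional:
  assumes e: "q e = 0" "tr e = 1" and span: "span {e, \<one> - e} = UNIV"
    and R: "rota_baxter0 scale mult R"
  shows "R x = 0"
proof -
  note lin = rota_baxter_linear[OF R]
  define f where "f = \<one> - e"
  note pf = idempotent_polar[OF e, folded f_def]
  have coords: "\<exists>a b. y = a *s e + b *s f" for y
  proof -
    have "y \<in> span {e, f}"
      using span by (simp add: f_def)
    then obtain a b where "y - a *s e = b *s f"
      unfolding span_insert[of e] span_singleton by blast
    then have "y = a *s e + b *s f"
      by (simp add: diff_eq_eq add.commute)
    then show ?thesis by blast
  qed
  have norm: "q (a *s e + b *s f) = a * b" for a b
    by (simp add: norm_add norm_scale bilinear pf e)
  obtain a b where ab: "R \<one> = a *s e + b *s f"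
    using coords by blast
  have "a * b = 0" "a + b = 0"
    using norm_rota_baxter[OF R, of \<one>] rota_baxter_one(1)[OF R]
    by (simp_all add: ab norm bilinear pf e)
  then have c: "R \<one> = 0"
    using ab by (auto simp: add_eq_0_iff)
  then have Rf: "R f = - R e"
    by (simp add: f_def lin)
  have RR: "R (R y) = 0" for y
    using rota_baxter_mult[OF R, of y \<one>] c by simp
  obtain a b where ab: "R e = a *s e + b *s f"
    using coords by blast
  have prod: "a * b = 0"
    using norm_rota_baxter[OF R, of e] by (simp add: ab norm)
  have "(a - b) *s R e = R (R e)"
    by (subst (2) ab) (simp add: lin Rf algebra_simps)
  then have "a = b \<or> R e = 0"
    using RR by simp
  then have "R e = 0"
    using prod ab by auto
  then show ?thesis
    using coords[of x] Rf by (auto simp: lin)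
qed

lemma peirce_vector_exists:
  assumes e: "q e = 0" "tr e = 1" and span: "span {e, \<one> - e} \<noteq> UNIV"
  obtains e' u where "q e' = 0" "tr e' = 1" "u \<noteq> 0" "e' \<odot> u = u" "u \<odot> e' = 0"
proof -
  define f where "f = \<one> - e"
  note pf = idempotent_polar[OF e, folded f_def]
  obtain x where x: "x \<notin> span {e, f}"
    using span by (auto simp: f_def)
  \<comment> \<open>Projection off the hyperbolic plane of \<open>e\<close> and \<open>f\<close>;
    the coefficients are crossed because both vectors are isotropic and
    \<open>B e f = 1\<close>.\<close>
  define v where "v = x - (B x f *s e + B x e *s f)"
  have "B x f *s e + B x e *s f \<in> span {e, f}"
    by (intro span_add span_scale span_base) auto
  then have v0: "v \<noteq> 0"
    using x by (auto simp: v_def)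
  have ve: "B v e = 0" and vf: "B v f = 0"
    using pf e by (simp_all add: v_def bilinear polar_self polar_commute)
  then have trv: "tr v = 0"
    by (simp add: f_def bilinear)
  have anti: "e \<odot> v + v \<odot> e = v"
    using mult_anticommutator[of e v] e trv ve by (simp add: polar_commute)
  show ?thesis
  proof (cases "e \<odot> v = 0")
    case False
    have l: "e \<odot> (e \<odot> v) = e \<odot> v"
      using left_quadratic[of e v] e by simp
    have "tr (e \<odot> v) = 0" "B e (e \<odot> v) = 0"
      using e trv ve polar_mult_left[of e \<one> v] by (simp_all add: tr_mult polar_commute[of e v])
    then have "(e \<odot> v) \<odot> e = 0"
      using mult_anticommutator[of e "e \<odot> v"] e l by simp
    then show ?thesis
      using that[OF e False l] by blast
  next
    case True
    \<comment> \<open>Here \<open>v \<odot> e = v\<close>, so \<open>v\<close> itself serves once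
      \<open>e\<close> is exchanged for \<open>f\<close>.\<close>
    then have "f \<odot> v = v" "v \<odot> f = 0"
      using anti by (simp_all add: f_def bilinear)
    then show ?thesis
      using that[OF pf(2,3) v0] by blast
  qed
qed

text \<open>The operator below is \<open>e21 \<mapsto> -e11, e11 \<mapsto> e12\<close> on a copy of the 2-by-2 matrices with
  \<open>e = e11\<close> and \<open>u = e12\<close>, extended by zero to the orthogonal complement.\<close>

lemma rota_baxter_nonzero_square:
  assumes e: "q e = 0" "tr e = 1" and u: "u \<noteq> 0" "e \<odot> u = u" "u \<odot> e = 0"
  obtains R x where "rota_baxter0 scale mult R" "R (R x) \<noteq> 0"
proof -
  define f where "f = \<one> - e"
  note pf = idempotent_polar[OF e, folded f_def]
  define R where "R x = B u x *s e + B f x *s u" for x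
  have qu: "q u = 0"
    using norm_mult[of e u] u e by simp
  have ue: "B u e = 0"
    using polar_mult_left[of e u \<one>] u e by simp
  have tru: "tr u = 0"
    using tr_mult[of u e] u e ue by simp
  have uu: "u \<odot> u = 0"
    using square_eq[of u] qu tru by simp
  \<comment> \<open>As \<open>R x\<close> is a combination of \<open>e\<close> and \<open>u\<close>,
    these pairings determine \<open>R\<close> on \<open>R x \<odot> y + x \<odot> R y\<close>; all
    come from adjointness.\<close>
  have u_ey: "B u (e \<odot> y) = 0" and u_xe: "B u (y \<odot> e) = B u y"
    and u_uy: "B u (u \<odot> y) = 0" and u_yu: "B u (y \<odot> u) = 0"
    and f_ey: "B f (e \<odot> y) = B f y" and f_ye: "B f (y \<odot> e) = B f y"
    and f_uy: "B f (u \<odot> y) = - B u y" and f_yu: "B f (y \<odot> u) = 0" for y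
    using polar_adjoint_left[of e u y] polar_adjoint_right[of u e y]
      polar_adjoint_left[of u u y] polar_adjoint_right[of u u y]
      polar_adjoint_left[of e f y] polar_adjoint_right[of f e y]
      polar_adjoint_left[of u f y] polar_adjoint_right[of f u y]
      u e uu qu tru pf(4)
    by (simp_all add: f_def bilinear)
  have "rota_baxter0 scale mult R"
    unfolding rota_baxter0_def Vector_Spaces.linear_iff
  proof (intro conjI allI)
    show "R x \<odot> R y = R (R x \<odot> y + x \<odot> R y)" for x y
      by (simp add: R_def bilinear u_ey u_xe u_uy u_yu f_ey f_ye f_uy f_yu u uu pf algebra_simps)
  qed (use vector_space_axioms in \<open>auto simp: R_def bilinear algebra_simps\<close>)
  moreover have "R (R x) = B u x *s u" for x
  proof -
    have "B f e = 1" "B f u = 0" "B u u = 0"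
      using pf ue tru qu by (simp_all add: polar_self polar_commute f_def bilinear)
    then show ?thesis
      by (simp add: R_def bilinear ue)
  qed
  moreover obtain x where "B u x \<noteq> 0"
    using polar_nonzero u by blast
  ultimately show ?thesis
    using that u by auto
qed

section \<open>Values of the index\<close>

lemma rb_index_division:
  assumes "division_ca q"
  shows "rb_index scale mult = 1"
  using assms norm_rota_baxter by (intro rb_index_eq_1) (auto simp: division_ca_def split_ca_def)

lemma rb_index_dim_le_2:
  assumes dim: "dim (UNIV :: 'v set) \<le> 2"
  shows "rb_index scale mult = 1"
proof (cases "split_ca q")
  case True
  then obtain e where e: "q e = 0" "tr e = 1"
    by (rule split_idempotent)
  define f where "f = \<one> - e"
  note pf = idempotent_polar[OF e, folded f_def]
  have ind: "independent {e, f}" and ef: "e \<noteq> f"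
  proof -
    show ef: "e \<noteq> f"
      using pf e by (auto simp: polar_self)
    have "f \<noteq> 0"
      using pf by auto
    moreover have "e \<notin> span {f}"
      using pf by (auto simp: span_singleton bilinear polar_self)
    ultimately show "independent {e, f}"
      using ef by (simp add: independent_insert)
  qed
  obtain S where S: "finite S" "span S = UNIV"
    using finite_dimensional by blast
  obtain T where T: "independent T" "span T = UNIV" "card T = dim (UNIV :: 'v set)"
    using basis_exists[of UNIV] by (metis top.extremum_uniqueI)
  \<comment> \<open>An infinite \<open>T\<close> would have \<open>card\<close> 0, so finiteness is
    needed before \<open>dim\<close> can bound independent sets.\<close>
  have "finite T"
    using independent_span_bound[of S T] S T by simp
  have "span {e, f} = UNIV"
  proof (rule ccontr)
    assume "span {e, f} \<noteq> UNIV"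
    then obtain x where "x \<notin> span {e, f}"
      by blast
    moreover from this have "x \<noteq> e" "x \<noteq> f"
      using span_base[of _ "{e, f}"] by auto
    ultimately have "independent {x, e, f}" "card {x, e, f} = 3"
      using ind ef by (auto simp: independent_insert)
    then show False
      using independent_span_bound[of T "{x, e, f}"] \<open>finite T\<close> T dim by simp
  qed
  then have "span {e, \<one> - e} = UNIV"
    by (simp add: f_def)
  then show ?thesis
    using rota_baxter_zero_two_dimensional[OF e] by (intro rb_index_eq_1) blast
next
  case False
  then show ?thesis
    by (simp add: rb_index_division division_ca_def)
qed

text \<open>In dimension above 2 the two idempotents cannot span, so a Peirce vector and with it an
  operator of nonzero square exist.\<close>

lemma rb_index_split:
  assumes "split_ca q" and dim: "2 < dim (UNIV :: 'v set)"
  shows "rb_index scale mult = 3"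
proof -
  obtain e where e: "q e = 0" "tr e = 1"
    using split_idempotent assms by blast
  have "card {e, \<one> - e} \<le> 2"
    by (simp add: card_insert_if)
  then have "span {e, \<one> - e} \<noteq> UNIV"
    using dim dim_le_card[of UNIV "{e, \<one> - e}"] by auto
  then obtain e' u where "q e' = 0" "tr e' = 1" "u \<noteq> 0" "e' \<odot> u = u" "u \<odot> e' = 0"
    using peirce_vector_exists[OF e] by blast
  then obtain R x where "rota_baxter0 scale mult R" "R (R x) \<noteq> 0"
    using rota_baxter_nonzero_square by blast
  then show ?thesis
    by (rule rb_index_eq_3)
qed

end

theorem mainTheorem20:
  fixes scale :: "'a::field_char_0 \<Rightarrow> 'v::ab_group_add \<Rightarrow> 'v"
    and mult :: "'v \<Rightarrow> 'v \<Rightarrow> 'v"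
    and q :: "'v \<Rightarrow> 'a"
  assumes "composition_algebra scale mult q"
    and "unital mult"
  shows "((division_ca q \<or> vector_space.dim scale (UNIV :: 'v set) \<le> 2)
           \<longrightarrow> rb_index scale mult = 1)
       \<and> ((split_ca q \<and> vector_space.dim scale (UNIV :: 'v set) \<in> {4, 8})
           \<longrightarrow> rb_index scale mult = 3)"
proof -
  obtain e where e: "e \<noteq> 0" "\<And>x. mult e x = x" "\<And>x. mult x e = x"
    using assms(2) unfolding unital_def by blast
  interpret vector_space scale
    using assms(1) by (simp add: composition_algebra_def)
  interpret unital_composition_algebra scale mult q e
    using assms(1) e by unfold_locales
  show ?thesis
    using rb_index_division rb_index_dim_le_2 rb_index_split by auto
qed

end
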